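(* There exists a computational problem (a relation), defined for infinitely many network sizes $n$, that can be solved with $2$ rounds in the quantum LOCAL model, but requires $\Omega(n)$ rounds in the classical LOCAL model, where $n$ denotes the number of nodes in the network. The classical lower bound holds even if the nodes are allowed to share arbitrary prior randomness.
   Context: LOCAL model: the network is an undirected unweighted graph; each node is a processor with a distinct identifier, initially knowing only its incident edges and the total number $n$ of nodes. Computation proceeds in synchronous rounds; in each round every node may perform arbitrary local computation and send one message of unbounded size to each neighbour. In the classical LOCAL model processors are probabilistic and messages are classical; in the quantum LOCAL model processors are quantum and messages are quantum states (any number of qubits). Initially the nodes share neither randomness nor entanglement (except where explicitly allowed). The round complexity is the number of rounds. A computational problem (relation) specifies for each network an input at each node and, for each input, a set of valid outputs (one output per node); an algorithm solves it if on every input it produces a valid output with bounded error (e.g., with probability at least $2/3$). *)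

theory Defs
  imports "HOL-Probability.Probability"
begin

text \<open>A network is a finite simple undirected graph whose nodes ARE their (distinct) identifiers:
  V is a finite set of natural numbers, E a symmetric irreflexive edge relation inside V.
  A node v initially knows its identifier v, the identifiers of its neighbours (its incident
  edges), its input, and n = card V.\<close>

definition network :: "nat set \<Rightarrow> (nat \<Rightarrow> nat \<Rightarrow> bool) \<Rightarrow> bool" where
  "network V E \<longleftrightarrow> finite V \<and> (\<forall>u v. E u v \<longrightarrow> u \<in> V \<and> v \<in> V \<and> u \<noteq> v \<and> E v u)"

definition nbrs :: "(nat \<Rightarrow> nat \<Rightarrow> bool) \<Rightarrow> nat \<Rightarrow> nat set" where
  "nbrs E v = {u. E v u}"

text \<open>A computational problem (relation): the instances (network together with an input at every
  node; inputs and outputs are encoded as natural numbers) on which it is defined, and for each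
  instance the set of valid output vectors.\<close>

record problem =
  pr_inst  :: "nat set \<Rightarrow> (nat \<Rightarrow> nat \<Rightarrow> bool) \<Rightarrow> (nat \<Rightarrow> nat) \<Rightarrow> bool"
  pr_valid :: "nat set \<Rightarrow> (nat \<Rightarrow> nat \<Rightarrow> bool) \<Rightarrow> (nat \<Rightarrow> nat) \<Rightarrow> (nat \<Rightarrow> nat) \<Rightarrow> bool"

definition instance_sizes :: "problem \<Rightarrow> nat set" where
  "instance_sizes P = {card V | V E x. network V E \<and> pr_inst P V E x}"

text \<open>Universal data type for local states and (unbounded) messages.\<close>
datatype dat = DNat nat | DReal real | DList "dat list"

record calg =
  c_init :: "nat \<Rightarrow> nat set \<Rightarrow> nat \<Rightarrow> real \<Rightarrow> real \<Rightarrow> dat"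
    \<comment> \<open>identifier, neighbour identifiers, input, private random real, shared random real\<close>
  c_send :: "nat \<Rightarrow> dat \<Rightarrow> nat \<Rightarrow> dat"
    \<comment> \<open>round, current state, recipient neighbour\<close>
  c_upd  :: "nat \<Rightarrow> dat \<Rightarrow> (nat \<Rightarrow> dat) \<Rightarrow> dat"
    \<comment> \<open>round, current state, received messages indexed by sender\<close>
  c_out  :: "dat \<Rightarrow> nat"

fun c_state :: "calg \<Rightarrow> (nat \<Rightarrow> nat \<Rightarrow> bool) \<Rightarrow> (nat \<Rightarrow> nat) \<Rightarrow> (nat \<Rightarrow> real) \<Rightarrow> real
                 \<Rightarrow> nat \<Rightarrow> nat \<Rightarrow> dat" where
  "c_state A E x p s 0 v = c_init A v (nbrs E v) (x v) (p v) s"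
| "c_state A E x p s (Suc r) v =
     c_upd A r (c_state A E x p s r v)
       (\<lambda>u. if E u v then c_send A r (c_state A E x p s r u) v else DList [])"

definition c_output :: "calg \<Rightarrow> nat set \<Rightarrow> (nat \<Rightarrow> nat \<Rightarrow> bool) \<Rightarrow> (nat \<Rightarrow> nat) \<Rightarrow> nat
                        \<Rightarrow> (nat \<Rightarrow> real) \<Rightarrow> real \<Rightarrow> nat \<Rightarrow> nat" where
  "c_output A V E x T p s = (\<lambda>v. if v \<in> V then c_out A (c_state A E x p s T v) else 0)"

definition U01 :: "real measure" where
  "U01 = uniform_measure lborel {0..1}"

definition rand_space :: "nat set \<Rightarrow> ((nat \<Rightarrow> real) \<times> real) measure" where
  "rand_space V = (PiM V (\<lambda>_. U01)) \<Otimes>\<^sub>M U01"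

text \<open>A classical algorithm solves P on networks of size n in T rounds if on every instance of
  size n the output is valid with probability at least 2/3 (inner probability, so that
  non-measurable algorithms are also covered).\<close>
definition classically_solves :: "problem \<Rightarrow> nat \<Rightarrow> nat \<Rightarrow> calg \<Rightarrow> bool" where
  "classically_solves P n T A \<longleftrightarrow>
     (\<forall>V E x. network V E \<and> card V = n \<and> pr_inst P V E x \<longrightarrow>
        (\<exists>S \<in> sets (rand_space V).
            S \<subseteq> {\<omega> \<in> space (rand_space V).
                   pr_valid P V E x (c_output A V E x T (fst \<omega>) (snd \<omega>))}
          \<and> measure (rand_space V) S \<ge> 2/3))"

text \<open>Qubits: Loc v j is the j-th private qubit of node v; Msg r u v j is the j-th qubit of the
  message sent from u to v in round r. All qubits start in |0>. No shared entanglement.\<close>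
datatype qubit = Loc nat nat | Msg nat nat nat nat

type_synonym config = "qubit \<Rightarrow> bool"

definition configs :: "qubit set \<Rightarrow> config set" where
  "configs S = {c. \<forall>q. q \<notin> S \<longrightarrow> \<not> c q}"

definition restr :: "config \<Rightarrow> qubit set \<Rightarrow> config" where
  "restr c S = (\<lambda>q. q \<in> S \<and> c q)"

definition unitary_on :: "qubit set \<Rightarrow> (config \<Rightarrow> config \<Rightarrow> complex) \<Rightarrow> bool" where
  "unitary_on S U \<longleftrightarrow> finite S \<and>
     (\<forall>c \<in> configs S. \<forall>d \<in> configs S.
        (\<Sum>e \<in> configs S. cnj (U e c) * U e d) = (if c = d then 1 else 0))"

definition apply_op :: "qubit set \<Rightarrow> (config \<Rightarrow> config \<Rightarrow> complex)
                         \<Rightarrow> (config \<Rightarrow> complex) \<Rightarrow> (config \<Rightarrow> complex)" where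
  "apply_op S U \<psi> = (\<lambda>c. \<Sum>d \<in> {d. \<forall>q. q \<notin> S \<longrightarrow> d q = c q}. U (restr c S) (restr d S) * \<psi> d)"

definition psi0 :: "config \<Rightarrow> complex" where
  "psi0 = (\<lambda>c. if c = (\<lambda>_. False) then 1 else 0)"

record qalg =
  q_loc :: "nat \<Rightarrow> nat"   \<comment> \<open>number of private qubits per node, as a function of n\<close>
  q_msg :: "nat \<Rightarrow> nat"   \<comment> \<open>number of qubits per message, as a function of n\<close>
  q_U   :: "nat \<Rightarrow> nat \<Rightarrow> nat \<Rightarrow> nat set \<Rightarrow> nat \<Rightarrow> (config \<Rightarrow> config \<Rightarrow> complex)"
    \<comment> \<open>round r, n, identifier, neighbour identifiers, input: local unitary\<close>
  q_out :: "nat \<Rightarrow> nat \<Rightarrow> nat set \<Rightarrow> nat \<Rightarrow> config \<Rightarrow> nat"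
    \<comment> \<open>n, identifier, neighbours, input, measured outcome: output\<close>

text \<open>Qubits held by node v during round r (1 \<le> r \<le> t), where it processes the messages received in
  round r-1 and prepares the messages of round r; r = t+1 is the final local computation.\<close>
definition owned :: "nat \<Rightarrow> nat \<Rightarrow> nat \<Rightarrow> nat \<Rightarrow> nat \<Rightarrow> nat set \<Rightarrow> qubit set" where
  "owned t L M r v N =
     {Loc v j | j. j < L}
   \<union> {Msg (r - 1) u v j | u j. u \<in> N \<and> j < M \<and> 2 \<le> r}
   \<union> {Msg r v u j | u j. u \<in> N \<and> j < M \<and> r \<le> t}"

definition q_round :: "qalg \<Rightarrow> nat \<Rightarrow> nat set \<Rightarrow> (nat \<Rightarrow> nat \<Rightarrow> bool) \<Rightarrow> (nat \<Rightarrow> nat)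
                        \<Rightarrow> nat \<Rightarrow> (config \<Rightarrow> complex) \<Rightarrow> (config \<Rightarrow> complex)" where
  "q_round A t V E x r \<psi> =
     fold (\<lambda>v \<phi>. apply_op (owned t (q_loc A (card V)) (q_msg A (card V)) r v (nbrs E v))
                           (q_U A r (card V) v (nbrs E v) (x v)) \<phi>)
          (sorted_list_of_set V) \<psi>"

definition q_final :: "qalg \<Rightarrow> nat \<Rightarrow> nat set \<Rightarrow> (nat \<Rightarrow> nat \<Rightarrow> bool) \<Rightarrow> (nat \<Rightarrow> nat)
                        \<Rightarrow> (config \<Rightarrow> complex)" where
  "q_final A t V E x = fold (q_round A t V E x) [1..<t+2] psi0"

definition q_qubits :: "qalg \<Rightarrow> nat \<Rightarrow> nat set \<Rightarrow> (nat \<Rightarrow> nat \<Rightarrow> bool) \<Rightarrow> qubit set" where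
  "q_qubits A t V E =
     (\<Union>v \<in> V. \<Union>r \<in> {1..t+1}. owned t (q_loc A (card V)) (q_msg A (card V)) r v (nbrs E v))"

text \<open>Final measurement in the computational basis; node v's output depends only on the qubits
  it holds at the end.\<close>
definition q_output :: "qalg \<Rightarrow> nat \<Rightarrow> nat set \<Rightarrow> (nat \<Rightarrow> nat \<Rightarrow> bool) \<Rightarrow> (nat \<Rightarrow> nat)
                         \<Rightarrow> config \<Rightarrow> nat \<Rightarrow> nat" where
  "q_output A t V E x c = (\<lambda>v. if v \<in> V then
      q_out A (card V) v (nbrs E v) (x v)
        (restr c (owned t (q_loc A (card V)) (q_msg A (card V)) (t+1) v (nbrs E v)))
     else 0)"

definition q_wellformed :: "qalg \<Rightarrow> nat \<Rightarrow> bool" where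
  "q_wellformed A t \<longleftrightarrow>
     (\<forall>r \<in> {1..t+1}. \<forall>n v N x. finite N \<longrightarrow>
        unitary_on (owned t (q_loc A n) (q_msg A n) r v N) (q_U A r n v N x))"

definition quantumly_solves :: "problem \<Rightarrow> nat \<Rightarrow> qalg \<Rightarrow> bool" where
  "quantumly_solves P t A \<longleftrightarrow> q_wellformed A t \<and>
     (\<forall>V E x. network V E \<and> pr_inst P V E x \<longrightarrow>
        (\<Sum>c \<in> {c \<in> configs (q_qubits A t V E). pr_valid P V E x (q_output A t V E x c)}.
            (cmod (q_final A t V E x c))\<^sup>2) \<ge> 2/3)"

end

theory Submission
  imports Defs
begin

text \<open>On a graph every node prepares a cat state shared with its neighbours, and each node measures the
  parity of its bit with the bits it receives. The outcomes are the coboundary of a random set \<open>Y\<close> of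
  nodes, and what is left is the global state \<open>|Y> + |V - Y>\<close>, a GHZ state up to bit flips which the
  outcomes reveal. Measuring each node in the X or Y basis according to its input bit then yields the GHZ
  parity, corrected by the sum of \<open>x v\<close> over \<open>v \<in> Y\<close>.

  On a spider with five arms of length \<open>L\<close> whose inputs sit at the leaves, a classical algorithm
  with fewer than \<open>L\<close> rounds lets the outputs on an arm depend only on the input at the end of that arm.
  The correction \<open>x v\<close> times the membership of the leaf \<open>v\<close> in \<open>Y\<close> is local to the arm
  as well, except for the membership of the centre, which cancels because the inputs have even weight. So
  for each value of the randomness the algorithm is a classical strategy for Mermin's five-party game,
  which wins on at most 10 of the 16 inputs, and 10/16 < 2/3.\<close>

subsection \<open>Local operations on disjoint registers\<close>

definition merge_config :: "qubit set \<Rightarrow> config \<Rightarrow> config \<Rightarrow> config" where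
  "merge_config S e c = (\<lambda>q. if q \<in> S then e q else c q)"

lemma finite_configs [simp]: "finite S \<Longrightarrow> finite (configs S)"
proof -
  assume "finite S"
  have "configs S \<subseteq> (\<lambda>A q. q \<in> A) ` Pow S"
  proof
    fix c assume "c \<in> configs S"
    then have "c = (\<lambda>q. q \<in> {q. c q})" "{q. c q} \<in> Pow S" by (auto simp: configs_def)
    then show "c \<in> (\<lambda>A q. q \<in> A) ` Pow S" by blast
  qed
  then show ?thesis using \<open>finite S\<close> by (meson finite_Pow_iff finite_imageI finite_subset)
qed

lemma restr_in_configs [simp]: "restr c S \<in> configs S"
  by (auto simp: restr_def configs_def)

lemma restr_merge [simp]: "e \<in> configs S \<Longrightarrow> restr (merge_config S e c) S = e"
  by (auto simp: restr_def configs_def merge_config_def)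

lemma merge_merge [simp]: "merge_config S d (merge_config S e c) = merge_config S d c"
  by (auto simp: merge_config_def)

lemma apply_op_eq:
  "apply_op S U \<psi> c = (\<Sum>e\<in>configs S. U (restr c S) e * \<psi> (merge_config S e c))"
  unfolding apply_op_def
  by (rule sum.reindex_bij_witness[where i="\<lambda>e. merge_config S e c" and j="\<lambda>d. restr d S"])
     (auto simp: merge_config_def restr_def configs_def fun_eq_iff intro!: arg_cong[of _ _ \<psi>])

lemma sum_configs_split:
  fixes F :: "config \<Rightarrow> 'a::comm_monoid_add"
  assumes "S \<subseteq> Q"
  shows "sum F (configs Q) = (\<Sum>r\<in>configs (Q - S). \<Sum>e\<in>configs S. F (merge_config S e r))"
proof -
  have "sum F (configs Q) = (\<Sum>(r, e)\<in>configs (Q - S) \<times> configs S. F (merge_config S e r))"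
    using assms
    by (intro sum.reindex_bij_witness[where i="\<lambda>(r, e). merge_config S e r"
          and j="\<lambda>c. (restr c (Q - S), restr c S)"])
       (auto simp: merge_config_def restr_def configs_def fun_eq_iff intro!: arg_cong[of _ _ F])
  then show ?thesis by (simp add: sum.cartesian_product)
qed

section \<open>Norm preservation under local unitaries\<close>

lemma unitary_on_isometry:
  assumes "unitary_on S U"
  shows "(\<Sum>e\<in>configs S. (cmod (\<Sum>d\<in>configs S. U e d * \<phi> d))\<^sup>2) = (\<Sum>d\<in>configs S. (cmod (\<phi> d))\<^sup>2)"
proof -
  let ?C = "configs S"
  have fin: "finite ?C" using assms by (auto simp: unitary_on_def)
  have "complex_of_real (\<Sum>e\<in>?C. (cmod (\<Sum>d\<in>?C. U e d * \<phi> d))\<^sup>2)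
      = (\<Sum>e\<in>?C. (\<Sum>d\<in>?C. U e d * \<phi> d) * (\<Sum>d'\<in>?C. cnj (U e d' * \<phi> d')))"
    unfolding of_real_sum complex_norm_square cnj_sum ..
  also have "\<dots> = (\<Sum>e\<in>?C. \<Sum>d\<in>?C. \<Sum>d'\<in>?C. (\<phi> d * cnj (\<phi> d')) * (cnj (U e d') * U e d))"
    by (simp add: sum_product algebra_simps)
  also have "\<dots> = (\<Sum>d\<in>?C. \<Sum>e\<in>?C. \<Sum>d'\<in>?C. (\<phi> d * cnj (\<phi> d')) * (cnj (U e d') * U e d))"
    by (rule sum.swap)
  also have "\<dots> = (\<Sum>d\<in>?C. \<Sum>d'\<in>?C. \<Sum>e\<in>?C. (\<phi> d * cnj (\<phi> d')) * (cnj (U e d') * U e d))"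
    by (intro sum.cong refl sum.swap)
  also have "\<dots> = (\<Sum>d\<in>?C. \<Sum>d'\<in>?C. (\<phi> d * cnj (\<phi> d')) * (if d' = d then 1 else 0))"
    using assms by (intro sum.cong refl) (simp add: sum_distrib_left[symmetric] unitary_on_def)
  also have "\<dots> = (\<Sum>d\<in>?C. \<phi> d * cnj (\<phi> d))"
    using fin by (intro sum.cong refl) (simp add: if_distrib sum.delta cong: if_cong)
  also have "\<dots> = complex_of_real (\<Sum>d\<in>?C. (cmod (\<phi> d))\<^sup>2)"
    unfolding of_real_sum complex_norm_square ..
  finally show ?thesis using of_real_eq_iff by blast
qed

text \<open>For each fixed configuration \<open>r\<close> of the qubits outside \<open>S\<close> the
  operation is \<open>U\<close> acting on a vector indexed by \<open>configs S\<close>, so unitarity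
  applies slice by slice.\<close>

lemma apply_op_norm:
  assumes "unitary_on S U" "S \<subseteq> Q"
  shows "(\<Sum>c\<in>configs Q. (cmod (apply_op S U \<psi> c))\<^sup>2) = (\<Sum>c\<in>configs Q. (cmod (\<psi> c))\<^sup>2)"
  unfolding sum_configs_split[OF assms(2)]
proof (rule sum.cong[OF refl])
  fix r
  show "(\<Sum>e\<in>configs S. (cmod (apply_op S U \<psi> (merge_config S e r)))\<^sup>2) = (\<Sum>e\<in>configs S. (cmod (\<psi> (merge_config S e r)))\<^sup>2)"
    using unitary_on_isometry[OF assms(1), of "\<lambda>e. \<psi> (merge_config S e r)"] by (simp add: apply_op_eq)
qed

lemma fold_apply_op_norm:
  assumes "\<And>v. v \<in> set vs \<Longrightarrow> unitary_on (S v) (U v) \<and> S v \<subseteq> Q"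
  shows "(\<Sum>c\<in>configs Q. (cmod (fold (\<lambda>v. apply_op (S v) (U v)) vs \<psi> c))\<^sup>2)
       = (\<Sum>c\<in>configs Q. (cmod (\<psi> c))\<^sup>2)"
  using assms
proof (induction vs arbitrary: \<psi>)
  case (Cons v vs)
  then show ?case by (simp add: apply_op_norm)
qed simp

lemma finite_owned: "finite N \<Longrightarrow> finite (owned t l m r v N)"
proof -
  assume "finite N"
  have "owned t l m r v N \<subseteq> Loc v ` {..<l} \<union> (\<lambda>(u, j). Msg (r - 1) u v j) ` (N \<times> {..<m})
       \<union> (\<lambda>(u, j). Msg r v u j) ` (N \<times> {..<m})"
    by (auto simp: owned_def)
  then show ?thesis using \<open>finite N\<close>
    by (meson finite_SigmaI finite_UnI finite_imageI finite_lessThan finite_subset)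
qed

text \<open>Success can thus be proved without computing the amplitudes of valid outcomes: it
  suffices that invalid outcomes have amplitude zero.\<close>

lemma q_final_norm:
  assumes "q_wellformed A t" "finite V" "\<And>v. finite (nbrs E v)"
  shows "(\<Sum>c\<in>configs (q_qubits A t V E). (cmod (q_final A t V E x c))\<^sup>2) = 1"
proof -
  let ?Q = "q_qubits A t V E"
  have step: "(\<Sum>c\<in>configs ?Q. (cmod (fold (q_round A t V E x) rs \<psi> c))\<^sup>2)
      = (\<Sum>c\<in>configs ?Q. (cmod (\<psi> c))\<^sup>2)" if "set rs \<subseteq> {1..t+1}" for rs \<psi>
    using that
  proof (induction rs arbitrary: \<psi>)
    case (Cons r rs)
    have "(\<Sum>c\<in>configs ?Q. (cmod (q_round A t V E x r \<psi> c))\<^sup>2)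
        = (\<Sum>c\<in>configs ?Q. (cmod (\<psi> c))\<^sup>2)"
      unfolding q_round_def
    proof (rule fold_apply_op_norm)
      fix v assume "v \<in> set (sorted_list_of_set V)"
      then show "unitary_on (owned t (q_loc A (card V)) (q_msg A (card V)) r v (nbrs E v))
          (q_U A r (card V) v (nbrs E v) (x v)) \<and>
         owned t (q_loc A (card V)) (q_msg A (card V)) r v (nbrs E v) \<subseteq> ?Q"
        using assms Cons.prems unfolding q_wellformed_def q_qubits_def
        by (intro conjI SUP_upper2[of v V] SUP_upper2[of r]) auto
    qed
    then show ?case using Cons by simp
  qed simp
  have fin: "finite ?Q" using assms(2,3) by (simp add: q_qubits_def finite_owned)
  have "(\<Sum>c\<in>configs ?Q. (cmod (psi0 c))\<^sup>2) = (\<Sum>c\<in>configs ?Q. if c = (\<lambda>_. False) then 1 else 0)"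
    by (intro sum.cong) (auto simp: psi0_def)
  also have "\<dots> = 1" using fin by (simp add: configs_def finite_configs[unfolded configs_def])
  finally show ?thesis unfolding q_final_def by (subst step) auto
qed

text \<open>Each gate acts on a single factor of every branch. The coefficient \<open>k\<close> is
  general enough to absorb the factors already processed, which drives the induction.\<close>

lemma fold_apply_op_product:
  fixes k :: "'i \<Rightarrow> config \<Rightarrow> complex"
  assumes "distinct vs"
    and "\<And>v w. v \<in> set vs \<Longrightarrow> w \<in> set vs \<Longrightarrow> v \<noteq> w \<Longrightarrow> S v \<inter> S w = {}"
    and "\<And>i v e c. v \<in> set vs \<Longrightarrow> k i (merge_config (S v) e c) = k i c"
  shows "fold (\<lambda>v. apply_op (S v) (U v)) vs (\<lambda>c. \<Sum>i\<in>I. k i c * (\<Prod>v\<in>set vs. f i v (restr c (S v))))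
       = (\<lambda>c. \<Sum>i\<in>I. k i c * (\<Prod>v\<in>set vs. \<Sum>e\<in>configs (S v). U v (restr c (S v)) e * f i v e))"
  using assms
proof (induction vs arbitrary: k)
  case (Cons v vs)
  define F where "F i c = (\<Sum>e\<in>configs (S v). U v (restr c (S v)) e * f i v e)" for i c
  have other: "restr (merge_config (S v) e c) (S w) = restr c (S w)" "restr (merge_config (S w) e c) (S v) = restr c (S v)"
    if "w \<in> set vs" for w e c
  proof -
    have "S v \<inter> S w = {}" using Cons.prems(1) that Cons.prems(2)[of v w] by auto
    then show "restr (merge_config (S v) e c) (S w) = restr c (S w)"
      "restr (merge_config (S w) e c) (S v) = restr c (S v)"
      by (auto simp: restr_def merge_config_def fun_eq_iff)
  qed
  have 1: "apply_op (S v) (U v) (\<lambda>c. \<Sum>i\<in>I. k i c * (\<Prod>v\<in>set (v # vs). f i v (restr c (S v))))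
      = (\<lambda>c. \<Sum>i\<in>I. (k i c * F i c) * (\<Prod>v\<in>set vs. f i v (restr c (S v))))"
  proof
    fix c
    have "apply_op (S v) (U v) (\<lambda>c. \<Sum>i\<in>I. k i c * (\<Prod>v\<in>set (v # vs). f i v (restr c (S v)))) c
      = (\<Sum>e\<in>configs (S v). \<Sum>i\<in>I. U v (restr c (S v)) e * (k i c * (f i v e * (\<Prod>v\<in>set vs. f i v (restr c (S v))))))"
      unfolding apply_op_eq sum_distrib_left using Cons.prems
      by (intro sum.cong refl) (simp add: other cong: prod.cong)
    also have "\<dots> = (\<Sum>i\<in>I. \<Sum>e\<in>configs (S v). U v (restr c (S v)) e * (k i c * (f i v e * (\<Prod>v\<in>set vs. f i v (restr c (S v))))))"
      by (rule sum.swap)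
    also have "\<dots> = (\<Sum>i\<in>I. (k i c * F i c) * (\<Prod>v\<in>set vs. f i v (restr c (S v))))"
      unfolding F_def by (intro sum.cong refl) (simp add: sum_distrib_left sum_distrib_right mult_ac)
    finally show "apply_op (S v) (U v) (\<lambda>c. \<Sum>i\<in>I. k i c * (\<Prod>v\<in>set (v # vs). f i v (restr c (S v)))) c
      = (\<Sum>i\<in>I. (k i c * F i c) * (\<Prod>v\<in>set vs. f i v (restr c (S v))))" .
  qed
  \<comment> \<open>\<open>F\<close> depends only on the register of \<open>v\<close>, which the
    later gates leave alone, so it joins the coefficient.\<close>
  have "fold (\<lambda>v. apply_op (S v) (U v)) vs (\<lambda>c. \<Sum>i\<in>I. (k i c * F i c) * (\<Prod>v\<in>set vs. f i v (restr c (S v))))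
    = (\<lambda>c. \<Sum>i\<in>I. (k i c * F i c) * (\<Prod>v\<in>set vs. \<Sum>e\<in>configs (S v). U v (restr c (S v)) e * f i v e))"
    using Cons.prems by (intro Cons.IH) (auto simp: F_def other)
  then show ?case using Cons.prems(1) unfolding fold_Cons comp_def 1 by (simp add: F_def mult_ac)
qed simp

text \<open>The matrix, from input \<open>d\<close> to output \<open>c\<close>, of three operations
  in turn: XOR qubit \<open>l\<close> into the qubits of \<open>B\<close>, apply \<open>W\<close> to
  \<open>l\<close>, XOR the new \<open>l\<close> into the qubits of \<open>A\<close>. Both sets
  count only within \<open>S\<close>.\<close>

definition gate :: "qubit \<Rightarrow> qubit set \<Rightarrow> (bool \<Rightarrow> bool \<Rightarrow> complex) \<Rightarrow> qubit set \<Rightarrow> qubit set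
    \<Rightarrow> config \<Rightarrow> config \<Rightarrow> complex" where
  "gate l S W A B c d = (if \<forall>q\<in>S - {l}. (c q \<noteq> (q \<in> A \<and> c l)) = (d q \<noteq> (q \<in> B \<and> d l))
     then W (c l) (d l) else 0)"

lemma unitary_gate:
  assumes "finite S" "l \<in> S"
    and W: "\<And>a b. (\<Sum>e\<in>UNIV. cnj (W e a) * W e b) = (if a = b then 1 else 0)"
  shows "unitary_on S (gate l S W A B)"
  unfolding unitary_on_def
proof (intro conjI ballI)
  fix c d assume cd: "c \<in> configs S" "d \<in> configs S"
  \<comment> \<open>The gate leads from \<open>c\<close> only to \<open>h False\<close> and
    \<open>h True\<close>. \<open>K\<close> says that \<open>c\<close> and \<open>d\<close> agree
    off \<open>l\<close> after the first XOR; then both columns live on these two rows, and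
    otherwise their supports are disjoint.\<close>
  define h where "h b = (\<lambda>q. if q = l then b else q \<in> S \<and> ((c q \<noteq> (q \<in> B \<and> c l)) \<noteq> (q \<in> A \<and> b)))" for b
  define K where "K \<longleftrightarrow> (\<forall>q\<in>S - {l}. (c q \<noteq> (q \<in> B \<and> c l)) = (d q \<noteq> (q \<in> B \<and> d l)))"
  have hl: "h b l = b" for b by (simp add: h_def)
  have hq: "(h b q \<noteq> (q \<in> A \<and> b)) = (c q \<noteq> (q \<in> B \<and> c l))" if "q \<in> S - {l}" for b q
    using that unfolding h_def by simp blast
  have hc: "gate l S W A B (h b) c = W b (c l)" for b
    unfolding gate_def hl by (intro if_P ballI hq)
  have hd: "gate l S W A B (h b) d = (if K then W b (d l) else 0)" for b
    unfolding gate_def K_def by (simp only: hl hq cong: ball_cong)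
  have hS: "h ` UNIV \<subseteq> configs S" using assms(2) by (auto simp: configs_def h_def)
  have inj: "inj h" by (rule injI) (metis hl)
  have "(\<Sum>e\<in>configs S. cnj (gate l S W A B e c) * gate l S W A B e d)
      = (\<Sum>e\<in>h ` UNIV. cnj (gate l S W A B e c) * gate l S W A B e d)"
  proof (rule sum.mono_neutral_right)
    show "\<forall>e\<in>configs S - range h. cnj (gate l S W A B e c) * gate l S W A B e d = 0"
    proof
      fix e assume e: "e \<in> configs S - range h"
      have "e \<noteq> h (e l)" using e by auto
      moreover have "e = h (e l)" if "\<forall>q\<in>S - {l}. (e q \<noteq> (q \<in> A \<and> e l)) = (c q \<noteq> (q \<in> B \<and> c l))"
      proof
        fix q show "e q = h (e l) q"
          using that e unfolding h_def configs_def by (cases "q = l"; cases "q \<in> S") auto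
      qed
      ultimately have "gate l S W A B e c = 0" by (auto simp: gate_def)
      then show "cnj (gate l S W A B e c) * gate l S W A B e d = 0" by simp
    qed
  qed (use assms hS in auto)
  also have "\<dots> = (if K then (if c l = d l then 1 else 0) else 0)"
    using W[of "c l" "d l"] by (simp add: sum.reindex[OF inj] hc hd)
  also have "\<dots> = (if c = d then 1 else 0)"
  proof -
    have "c = d" if "K" "c l = d l"
    proof
      fix q show "c q = d q" using that cd unfolding K_def configs_def by (cases "q = l"; cases "q \<in> S") auto
    qed
    then show ?thesis by (auto simp: K_def)
  qed
  finally show "(\<Sum>e\<in>configs S. cnj (gate l S W A B e c) * gate l S W A B e d) = (if c = d then 1 else 0)" .
qed fact

subsection \<open>The cat state protocol\<close>

text \<open>A node's register meets this set in its outgoing messages in round 2 and in its incoming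
  ones in round 3, so one set serves both XORs.\<close>

definition msg2 :: "qubit set" where "msg2 = {q. \<exists>u v j. q = Msg 2 u v j}"

text \<open>Measuring after \<open>rot x\<close> is a Pauli-X measurement for \<open>x = 0\<close> and, up to the sign
  of the outcome convention, a Pauli-Y measurement for \<open>x = 1\<close>.\<close>

definition rot :: "nat \<Rightarrow> bool \<Rightarrow> bool \<Rightarrow> complex" where
  "rot x a b = (if b then \<i> ^ (2 * of_bool a + x) else 1) / complex_of_real (sqrt 2)"

text \<open>Round 1 does nothing. In round 2 a node prepares \<open>|0...0> + |1...1>\<close> on its private qubit and
  its outgoing messages; in round 3 it XORs the private qubit into the incoming messages, then rotates
  the private qubit. The parent of \<open>v\<close> is \<open>v - 5\<close>, truncated to the centre 0.\<close>

definition ghz_alg :: qalg where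
  "ghz_alg = \<lparr>q_loc = \<lambda>_. 1, q_msg = \<lambda>_. 1,
     q_U = \<lambda>r n v N x. gate (Loc v 0) (owned 2 1 1 r v N)
       (if r = 1 then \<lambda>a b. of_bool (a = b) else if r = 2 then rot 0 else rot x)
       (if r = 2 then msg2 else {}) (if r = 3 then msg2 else {}),
     q_out = \<lambda>n v N x c. of_bool (c (Loc v 0)) + 2 * of_bool (c (Msg 2 (v - 5) v 0))\<rparr>"

lemma rot_unitary: "(\<Sum>e\<in>UNIV. cnj (rot x e a) * rot x e b) = (if a = b then 1 else 0)"
proof -
  have s: "complex_of_real (sqrt 2) * complex_of_real (sqrt 2) = 2"
    by (simp flip: of_real_mult)
  have i: "(- \<i>) ^ x * \<i> ^ x = 1" by (simp flip: power_mult_distrib)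
  show ?thesis using i by (cases a; cases b) (auto simp: UNIV_bool rot_def s)
qed

lemma ghz_alg_wellformed: "q_wellformed ghz_alg 2"
  unfolding q_wellformed_def
proof (intro ballI allI impI)
  fix r n v x :: nat and N :: "nat set"
  assume "finite N"
  then show "unitary_on (owned 2 (q_loc ghz_alg n) (q_msg ghz_alg n) r v N) (q_U ghz_alg r n v N x)"
    unfolding ghz_alg_def qalg.simps
    using rot_unitary by (intro unitary_gate finite_owned) (auto simp: owned_def UNIV_bool)
qed

lemma apply_op_gate_id:
  assumes "finite S" "l \<in> S"
  shows "apply_op S (gate l S (\<lambda>a b. of_bool (a = b)) {} {}) \<psi> = \<psi>"
proof
  fix c
  have "apply_op S (gate l S (\<lambda>a b. of_bool (a = b)) {} {}) \<psi> c
     = (\<Sum>e\<in>configs S. if e = restr c S then \<psi> (merge_config S e c) else 0)"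
    unfolding apply_op_eq
  proof (rule sum.cong[OF refl])
    fix e assume "e \<in> configs S"
    then have "(\<forall>q\<in>S. restr c S q = e q) \<longleftrightarrow> e = restr c S"
      by (auto simp: configs_def restr_def fun_eq_iff)
    then show "gate l S (\<lambda>a b. of_bool (a = b)) {} {} (restr c S) e * \<psi> (merge_config S e c)
       = (if e = restr c S then \<psi> (merge_config S e c) else 0)"
      using assms(2) by (auto simp: gate_def)
  qed
  also have "\<dots> = \<psi> (merge_config S (restr c S) c)" using assms(1) by simp
  also have "merge_config S (restr c S) c = c" by (auto simp: merge_config_def restr_def)
  finally show "apply_op S (gate l S (\<lambda>a b. of_bool (a = b)) {} {}) \<psi> c = \<psi> c" .
qed

lemma prod_of_bool:
  "finite A \<Longrightarrow> (\<Prod>v\<in>A. (of_bool (P v) :: complex)) = of_bool (\<forall>v\<in>A. P v)"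
  by (induction A rule: finite_induct) auto

section \<open>Amplitudes of the protocol, branch by branch\<close>

locale ghz_network =
  fixes V :: "nat set" and E :: "nat \<Rightarrow> nat \<Rightarrow> bool" and x :: "nat \<Rightarrow> nat"
  assumes net: "network V E"
begin

definition S :: "nat \<Rightarrow> nat \<Rightarrow> qubit set" where
  "S r v = owned 2 1 1 r v (nbrs E v)"

abbreviation gt :: "nat \<Rightarrow> nat \<Rightarrow> config \<Rightarrow> config \<Rightarrow> complex" where
  "gt r v \<equiv> q_U ghz_alg r (card V) v (nbrs E v) (x v)"

text \<open>The branch after round 2 in which the nodes of \<open>Y\<close> hold bit 1, copied to
  all their outgoing messages.\<close>

definition cat_config :: "nat set \<Rightarrow> config" where
  "cat_config Y = (\<lambda>q. case q of Loc v j \<Rightarrow> v \<in> Y \<and> j = 0 | Msg r v u j \<Rightarrow> r = 2 \<and> v \<in> Y \<and> E v u \<and> j = 0)"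

lemma finV [simp]: "finite V" and finN [simp]: "finite (nbrs E v)"
proof -
  show "finite V" using net by (simp add: network_def)
  have "nbrs E v \<subseteq> V" using net by (auto simp: network_def nbrs_def)
  then show "finite (nbrs E v)" using \<open>finite V\<close> by (rule finite_subset)
qed

lemma finS [simp]: "finite (S r v)"
  by (simp add: S_def finite_owned)

lemma Loc_S [simp]: "Loc v 0 \<in> S r v"
  by (simp add: S_def owned_def)

lemma disj_S: "v \<noteq> w \<Longrightarrow> S r v \<inter> S r w = {}"
  \<comment> \<open>Truncated subtraction gives \<open>r - 1 = r\<close> only for
    \<open>r = 0\<close>, and then registers contain no incoming messages.\<close>
  by (cases "r - 1 = r") (auto simp: S_def owned_def)

lemma gt_eq: "gt r v = gate (Loc v 0) (S r v)
       (if r = 1 then \<lambda>a b. of_bool (a = b) else if r = 2 then rot 0 else rot (x v))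
       (if r = 2 then msg2 else {}) (if r = 3 then msg2 else {})"
  by (simp add: ghz_alg_def S_def)

lemma ball_S2: "(\<forall>q\<in>S 2 v - {Loc v 0}. P q) \<longleftrightarrow> (\<forall>u. E v u \<longrightarrow> P (Msg 1 u v 0) \<and> P (Msg 2 v u 0))"
  by (auto simp: S_def owned_def nbrs_def)

lemma ball_S3: "(\<forall>q\<in>S 3 v - {Loc v 0}. P q) \<longleftrightarrow> (\<forall>u. E v u \<longrightarrow> P (Msg 2 u v 0))"
  by (auto simp: S_def owned_def nbrs_def)

lemma Msg_S:
  "E v u \<Longrightarrow> Msg 1 u v 0 \<in> S 2 v" "E v u \<Longrightarrow> Msg 2 v u 0 \<in> S 2 v" "E v u \<Longrightarrow> Msg 2 u v 0 \<in> S 3 v"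
  by (auto simp: S_def owned_def nbrs_def)

lemma q_round_eq:
  "q_round ghz_alg 2 V E x r = fold (\<lambda>v. apply_op (S r v) (gt r v)) (sorted_list_of_set V)"
  by (simp add: q_round_def ghz_alg_def S_def fun_eq_iff)

lemma round1: "q_round ghz_alg 2 V E x 1 psi0 = psi0"
proof -
  have "apply_op (S 1 v) (gt 1 v) \<psi> = \<psi>" for v \<psi>
    using apply_op_gate_id[OF finS Loc_S] by (simp add: gt_eq)
  then have "fold (\<lambda>v. apply_op (S 1 v) (gt 1 v)) vs \<psi> = \<psi>" for vs \<psi>
    by (induction vs) auto
  then show ?thesis by (simp add: q_round_eq)
qed

text \<open>When the branches are basis configurations \<open>d i\<close>, each gate contributes a
  single matrix entry.\<close>

lemma fold_product:
  fixes k :: "'i \<Rightarrow> config \<Rightarrow> complex"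
  assumes "\<And>i v e c. v \<in> V \<Longrightarrow> k i (merge_config (S r v) e c) = k i c"
  shows "q_round ghz_alg 2 V E x r (\<lambda>c. \<Sum>i\<in>I. k i c * (\<Prod>v\<in>V. of_bool (restr c (S r v) = restr (d i) (S r v))))
       = (\<lambda>c. \<Sum>i\<in>I. k i c * (\<Prod>v\<in>V. gt r v (restr c (S r v)) (restr (d i) (S r v))))"
proof -
  have "(\<Sum>e\<in>configs (S r v). gt r v (restr c (S r v)) e * of_bool (e = restr (d i) (S r v)))
     = gt r v (restr c (S r v)) (restr (d i) (S r v))" for c i v
    by (simp add: of_bool_def if_distrib cong: if_cong)
  then show ?thesis
    using fold_apply_op_product[of "sorted_list_of_set V" "S r" k "gt r"
        "\<lambda>i v e. of_bool (e = restr (d i) (S r v))" I] assms disj_S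
    by (simp add: q_round_eq)
qed

text \<open>Puts a basis vector into the product form that \<open>fold_product\<close> expects; the
  factor for qubits outside all registers goes into the coefficient, since by
  \<open>outside_merge\<close> the gates do not affect it.\<close>

lemma of_bool_product:
  "(of_bool (c = d) :: complex) = of_bool (\<forall>q. q \<notin> (\<Union>v\<in>V. S r v) \<longrightarrow> \<not> c q)
     * (\<Prod>v\<in>V. of_bool (restr c (S r v) = restr d (S r v)))"
  if "\<And>q. q \<notin> (\<Union>v\<in>V. S r v) \<Longrightarrow> \<not> d q"
proof -
  have "c = d \<longleftrightarrow> (\<forall>q. q \<notin> (\<Union>v\<in>V. S r v) \<longrightarrow> \<not> c q) \<and> (\<forall>v\<in>V. restr c (S r v) = restr d (S r v))"
    (is "_ \<longleftrightarrow> ?R")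
  proof
    assume ?R
    show "c = d"
    proof
      fix q show "c q = d q"
        using \<open>?R\<close> that[of q] by (cases "q \<in> (\<Union>v\<in>V. S r v)") (auto simp: restr_def fun_eq_iff)
    qed
  next
    assume "c = d" then show ?R using that by blast
  qed
  then show ?thesis by (simp only: of_bool_conj prod_of_bool[OF finV])
qed

lemma outside_merge:
  "v \<in> V \<Longrightarrow> (\<forall>q. q \<notin> (\<Union>v\<in>V. S r v) \<longrightarrow> \<not> merge_config (S r v) e c q)
     \<longleftrightarrow> (\<forall>q. q \<notin> (\<Union>v\<in>V. S r v) \<longrightarrow> \<not> c q)"
  by (auto simp: merge_config_def)

text \<open>From all zeros, \<open>rot 0\<close> gives both values of the private bit the amplitude
  \<open>1 / sqrt 2\<close>, independently at each node, and the XOR copies the bit into the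
  messages.\<close>

lemma round2:
  "q_round ghz_alg 2 V E x 2 psi0
    = (\<lambda>c. \<Sum>Y\<in>Pow V. of_bool (c = cat_config Y) / complex_of_real (sqrt 2) ^ card V)"
proof -
  let ?K = "\<lambda>c. \<forall>q. q \<notin> (\<Union>v\<in>V. S 2 v) \<longrightarrow> \<not> c q"
  let ?s = "complex_of_real (sqrt 2)"
  have p: "psi0 = (\<lambda>c. \<Sum>i\<in>{()}. of_bool (?K c) * (\<Prod>v\<in>V. of_bool (restr c (S 2 v) = restr (\<lambda>_. False) (S 2 v))))"
  proof
    fix c show "psi0 c = (\<Sum>i\<in>{()}. of_bool (?K c) * (\<Prod>v\<in>V. of_bool (restr c (S 2 v) = restr (\<lambda>_. False) (S 2 v))))"
      using of_bool_product[of 2 "\<lambda>_. False" c] by (simp add: psi0_def of_bool_def)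
  qed
  have "q_round ghz_alg 2 V E x 2 psi0
     = (\<lambda>c. of_bool (?K c) * (\<Prod>v\<in>V. gt 2 v (restr c (S 2 v)) (restr (\<lambda>_. False) (S 2 v))))"
    unfolding p by (subst fold_product) (simp only: outside_merge, simp)
  also have "\<dots> = (\<lambda>c. \<Sum>Y\<in>Pow V. of_bool (c = cat_config Y) / ?s ^ card V)"
  proof
    fix c
    \<comment> \<open>The private qubits determine the branch. \<open>?G v\<close> is the condition
      under which the gate of \<open>v\<close> leads from all zeros to \<open>c\<close>.\<close>
    define Y where "Y = {v \<in> V. c (Loc v 0)}"
    let ?G = "\<lambda>v. \<forall>u. E v u \<longrightarrow> c (Msg 2 v u 0) = c (Loc v 0) \<and> \<not> c (Msg 1 u v 0)"
    have g: "gt 2 v (restr c (S 2 v)) (restr (\<lambda>_. False) (S 2 v)) = of_bool (?G v) / ?s" for v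
    proof -
      have "(\<forall>q\<in>S 2 v - {Loc v 0}. (restr c (S 2 v) q \<noteq> (q \<in> msg2 \<and> restr c (S 2 v) (Loc v 0)))
          = (restr (\<lambda>_. False) (S 2 v) q \<noteq> (q \<in> {} \<and> restr (\<lambda>_. False) (S 2 v) (Loc v 0)))) \<longleftrightarrow> ?G v"
        unfolding ball_S2 by (intro all_cong1 imp_cong refl) (auto simp: restr_def msg2_def Msg_S[simplified])
      then show ?thesis unfolding gt_eq gate_def by (simp add: rot_def restr_def)
    qed
    have "(\<Prod>v\<in>V. of_bool (?G v) / ?s) = of_bool (\<forall>v\<in>V. ?G v) / ?s ^ card V"
      unfolding prod_dividef prod_of_bool[OF finV] by simp
    then have "of_bool (?K c) * (\<Prod>v\<in>V. gt 2 v (restr c (S 2 v)) (restr (\<lambda>_. False) (S 2 v)))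
      = of_bool (?K c \<and> (\<forall>v\<in>V. ?G v)) / ?s ^ card V"
      unfolding g by simp
    also have "?K c \<and> (\<forall>v\<in>V. ?G v) \<longleftrightarrow> c = cat_config Y"
    proof
      assume *: "?K c \<and> (\<forall>v\<in>V. ?G v)"
      show "c = cat_config Y"
      proof
        fix q
        show "c q = cat_config Y q"
        proof (cases "q \<in> (\<Union>v\<in>V. S 2 v)")
          case True
          then obtain v where v: "v \<in> V" "q \<in> S 2 v" by blast
          then have G: "?G v" using * by blast
          consider "q = Loc v 0" | u where "E v u" "q = Msg 1 u v 0" | u where "E v u" "q = Msg 2 v u 0"
            using v(2) unfolding S_def owned_def nbrs_def by fastforce
          then show ?thesis
            by cases (use G v in \<open>auto simp: cat_config_def Y_def\<close>)
        next
          case False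
          then have "\<not> c q" using * by blast
          moreover have "\<not> cat_config Y q" using False
            by (cases q) (auto simp: S_def owned_def cat_config_def Y_def nbrs_def)
          ultimately show ?thesis by simp
        qed
      qed
    next
      assume *: "c = cat_config Y"
      have "?K c" unfolding *
      proof (intro allI impI)
        fix q assume "q \<notin> (\<Union>v\<in>V. S 2 v)"
        then show "\<not> cat_config Y q" by (cases q) (auto simp: S_def owned_def cat_config_def Y_def nbrs_def)
      qed
      moreover have "\<forall>v\<in>V. ?G v" unfolding * by (auto simp: cat_config_def)
      ultimately show "?K c \<and> (\<forall>v\<in>V. ?G v)" ..
    qed
    also have "of_bool (c = cat_config Y) / ?s ^ card V = (\<Sum>Z\<in>Pow V. of_bool (c = cat_config Z) / ?s ^ card V)"
    proof -
      \<comment> \<open>Distinct branches have distinct configurations, so at most one summand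
        survives.\<close>
      have "c = cat_config Z \<longleftrightarrow> c = cat_config Y \<and> Z = Y" if "Z \<in> Pow V" for Z
      proof -
        have "{v \<in> V. cat_config Z (Loc v 0)} = Z" using that by (auto simp: cat_config_def)
        then show ?thesis by (auto simp: Y_def)
      qed
      note iff = this
      have "(\<Sum>Z\<in>Pow V. of_bool (c = cat_config Z) / ?s ^ card V)
          = (\<Sum>Z\<in>Pow V. if Z = Y then of_bool (c = cat_config Y) / ?s ^ card V else 0)"
      proof (rule sum.cong[OF refl])
        fix Z assume "Z \<in> Pow V"
        show "of_bool (c = cat_config Z) / ?s ^ card V = (if Z = Y then of_bool (c = cat_config Y) / ?s ^ card V else 0)"
        proof (cases "Z = Y")
          case False
          then have "c \<noteq> cat_config Z" using iff \<open>Z \<in> Pow V\<close> by blast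
          then show ?thesis using False by simp
        qed simp
      qed
      also have "\<dots> = of_bool (c = cat_config Y) / ?s ^ card V"
        by (subst sum.delta) (auto simp: Y_def)
      finally show ?thesis by simp
    qed
    finally show "of_bool (?K c) * (\<Prod>v\<in>V. gt 2 v (restr c (S 2 v)) (restr (\<lambda>_. False) (S 2 v)))
      = (\<Sum>Y\<in>Pow V. of_bool (c = cat_config Y) / ?s ^ card V)" .
  qed
  finally show ?thesis .
qed

text \<open>The contribution of branch \<open>Y\<close> to outcome \<open>c\<close>, up to a common
  factor. It vanishes unless the messages show the coboundary of \<open>Y\<close>; the phases are
  those of \<open>rot (x v)\<close> on bit 1.\<close>

definition amp :: "config \<Rightarrow> nat set \<Rightarrow> complex" where
  "amp c Y = (\<Prod>v\<in>V. if \<forall>u. E v u \<longrightarrow> c (Msg 2 u v 0) = ((u \<in> Y) \<noteq> (v \<in> Y))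
      then \<i> ^ (if v \<in> Y then 2 * of_bool (c (Loc v 0)) + x v else 0) else 0)"

text \<open>The scalar collects the normalisation and the test for stray qubits; the amplitude
  vanishes as soon as the sum does.\<close>

lemma q_final_amp: "\<exists>k. q_final ghz_alg 2 V E x c = k * (\<Sum>Y\<in>Pow V. amp c Y)"
proof -
  let ?K = "\<lambda>c. \<forall>q. q \<notin> (\<Union>v\<in>V. S 3 v) \<longrightarrow> \<not> c q"
  let ?s = "complex_of_real (sqrt 2)"
  \<comment> \<open>Every qubit set in a branch is still held in round 3: a message of round 2
    belongs to its receiver.\<close>
  have out: "q \<notin> (\<Union>v\<in>V. S 3 v) \<Longrightarrow> Y \<subseteq> V \<Longrightarrow> \<not> cat_config Y q" for q Y
    using net by (cases q) (auto simp: S_def owned_def cat_config_def nbrs_def network_def)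
  have "q_final ghz_alg 2 V E x = q_round ghz_alg 2 V E x 3 (q_round ghz_alg 2 V E x 2 psi0)"
    using round1 by (simp add: q_final_def upt_rec numeral_eq_Suc)
  also have "q_round ghz_alg 2 V E x 2 psi0
     = (\<lambda>c. \<Sum>Y\<in>Pow V. (of_bool (?K c) / ?s ^ card V) * (\<Prod>v\<in>V. of_bool (restr c (S 3 v) = restr (cat_config Y) (S 3 v))))"
    unfolding round2
  proof (intro ext sum.cong refl)
    fix c Y assume "Y \<in> Pow V"
    then show "of_bool (c = cat_config Y) / ?s ^ card V = (of_bool (?K c) / ?s ^ card V) * (\<Prod>v\<in>V. of_bool (restr c (S 3 v) = restr (cat_config Y) (S 3 v)))"
      using out of_bool_product[of 3 "cat_config Y" c] by simp
  qed
  also have "q_round ghz_alg 2 V E x 3 \<dots>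
    = (\<lambda>c. \<Sum>Y\<in>Pow V. (of_bool (?K c) / ?s ^ card V) * (\<Prod>v\<in>V. gt 3 v (restr c (S 3 v)) (restr (cat_config Y) (S 3 v))))"
    by (intro fold_product) (simp only: outside_merge)
  finally have fin: "q_final ghz_alg 2 V E x c
    = (\<Sum>Y\<in>Pow V. (of_bool (?K c) / ?s ^ card V) * (\<Prod>v\<in>V. gt 3 v (restr c (S 3 v)) (restr (cat_config Y) (S 3 v))))"
    by simp
  have "gt 3 v (restr c (S 3 v)) (restr (cat_config Y) (S 3 v))
     = (if \<forall>u. E v u \<longrightarrow> c (Msg 2 u v 0) = ((u \<in> Y) \<noteq> (v \<in> Y))
      then \<i> ^ (if v \<in> Y then 2 * of_bool (c (Loc v 0)) + x v else 0) else 0) / ?s" if "v \<in> V" for v Y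
  proof -
    have "cat_config Y (Loc v 0) = (v \<in> Y)" by (simp add: cat_config_def)
    moreover have "cat_config Y (Msg 2 u v 0) = (u \<in> Y)" if "E v u" for u
      using that net by (auto simp: cat_config_def network_def)
    ultimately show ?thesis
      unfolding gt_eq gate_def ball_S3 by (auto simp: restr_def Msg_S rot_def msg2_def)
  qed
  then have "(\<Prod>v\<in>V. gt 3 v (restr c (S 3 v)) (restr (cat_config Y) (S 3 v))) = amp c Y / ?s ^ card V" for Y
    by (simp add: amp_def prod_dividef)
  then have "q_final ghz_alg 2 V E x c = (of_bool (?K c) / ?s ^ card V / ?s ^ card V) * (\<Sum>Y\<in>Pow V. amp c Y)"
    unfolding fin by (simp add: sum_distrib_left)
  then show ?thesis by blast
qed

text \<open>For a branch consistent with the messages, the phases of \<open>Y\<close> and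
  \<open>V - Y\<close> have a product fixed by the outcome and a square fixed by the weight of
  \<open>x\<close> on \<open>Y\<close>. Odd parity makes them opposite.\<close>

lemma q_final_zero:
  assumes ev: "even (\<Sum>v\<in>V. x v)"
    and inv: "\<And>Y. \<lbrakk>Y \<subseteq> V; \<And>u v. E v u \<Longrightarrow> c (Msg 2 u v 0) = ((u \<in> Y) \<noteq> (v \<in> Y))\<rbrakk>
      \<Longrightarrow> odd ((\<Sum>v\<in>V. of_bool (c (Loc v 0)) + x v * of_bool (v \<in> Y)) + (\<Sum>v\<in>V. x v) div 2)"
  shows "q_final ghz_alg 2 V E x c = 0"
proof -
  let ?C = "\<lambda>Y v. \<forall>u. E v u \<longrightarrow> c (Msg 2 u v 0) = ((u \<in> Y) \<noteq> (v \<in> Y))"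
  \<comment> \<open>The two branches \<open>Y\<close> and \<open>V - Y\<close> interfere destructively on invalid outcomes.\<close>
  have flip: "amp c (V - Y) = - amp c Y" if Y: "Y \<subseteq> V" for Y
  proof -
    \<comment> \<open>Complementing \<open>Y\<close> flips both memberships across an edge, so the
      coboundary stays the same.\<close>
    have C: "?C (V - Y) v \<longleftrightarrow> ?C Y v" if "v \<in> V" for v
      using net that by (auto simp: network_def)
    show ?thesis
    proof (cases "\<forall>v\<in>V. ?C Y v")
      case False
      then obtain v where v: "v \<in> V" "\<not> ?C Y v" by blast
      then have "amp c (V - Y) = 0" "amp c Y = 0"
        unfolding amp_def using C[OF v(1)] by (auto intro!: bexI[of _ v] simp del: not_all)
      then show ?thesis by simp
    next
      case True
      let ?w = "\<lambda>v. 2 * of_bool (c (Loc v 0)) + x v"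
      define p where "p Z = (\<Sum>v\<in>V. if v \<in> Z then ?w v else 0)" for Z
      have amp: "amp c Z = \<i> ^ p Z" if "\<forall>v\<in>V. ?C Z v" for Z
        using that by (simp add: amp_def p_def power_sum)
      have "p Y + p (V - Y) = (\<Sum>v\<in>V. ?w v)"
        unfolding p_def sum.distrib[symmetric] by (intro sum.cong) auto
      also have "\<dots> = 2 * ((\<Sum>v\<in>V. of_bool (c (Loc v 0))) + (\<Sum>v\<in>V. x v) div 2)"
        using ev by (simp add: sum.distrib sum_distrib_left)
      finally have pp: "p Y + p (V - Y) = 2 * ((\<Sum>v\<in>V. of_bool (c (Loc v 0))) + (\<Sum>v\<in>V. x v) div 2)" .
      have "p Y = 2 * (\<Sum>v\<in>V. of_bool (c (Loc v 0) \<and> v \<in> Y)) + (\<Sum>v\<in>V. x v * of_bool (v \<in> Y))"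
        unfolding p_def sum_distrib_left sum.distrib[symmetric] by (intro sum.cong) auto
      then have "even (p Y) \<longleftrightarrow> even (\<Sum>v\<in>V. x v * of_bool (v \<in> Y))" by simp
      moreover have "odd ((\<Sum>v\<in>V. of_bool (c (Loc v 0)) + x v * of_bool (v \<in> Y)) + (\<Sum>v\<in>V. x v) div 2)"
        using True net by (intro inv Y) (auto simp: network_def)
      ultimately have par: "even (p Y) \<noteq> even ((\<Sum>v\<in>V. of_bool (c (Loc v 0))) + (\<Sum>v\<in>V. x v) div 2)"
        by (auto simp: sum.distrib)
      \<comment> \<open>The product of the two phases equals minus the square of the first, and
        cancelling gives the sign.\<close>
      have "\<i> ^ p Y * \<i> ^ p (V - Y) = (-1) ^ ((\<Sum>v\<in>V. of_bool (c (Loc v 0))) + (\<Sum>v\<in>V. x v) div 2)"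
        unfolding power_add[symmetric] pp power_mult by simp
      also have "\<dots> = - ((-1) ^ p Y)" using par by (auto simp: minus_one_power_iff)
      also have "(-1) ^ p Y = \<i> ^ p Y * \<i> ^ p Y"
        unfolding power_mult_distrib[symmetric] by simp
      finally have "\<i> ^ p Y * \<i> ^ p (V - Y) = \<i> ^ p Y * (- (\<i> ^ p Y))" by (simp only: mult_minus_right)
      then have "\<i> ^ p (V - Y) = - (\<i> ^ p Y)" by (subst (asm) mult_left_cancel) auto
      then show ?thesis using amp[of Y] amp[of "V - Y"] True C by simp
    qed
  qed
  \<comment> \<open>Complementation permutes the branches, so the sum equals its own
    negative.\<close>
  have "(\<Sum>Y\<in>Pow V. amp c Y) = (\<Sum>Y\<in>Pow V. amp c (V - Y))"
    by (rule sum.reindex_bij_witness[where i="\<lambda>Y. V - Y" and j="\<lambda>Y. V - Y"])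
       (auto simp: double_diff)
  also have "\<dots> = - (\<Sum>Y\<in>Pow V. amp c Y)"
    by (simp add: flip sum_negf)
  finally have "(\<Sum>Y\<in>Pow V. amp c Y) = 0" by (simp add: equal_neg_zero)
  then show ?thesis using q_final_amp[of c] by auto
qed

end

subsection \<open>The parity problem on spiders\<close>

text \<open>Node \<open>5 * j + i + 1\<close> with \<open>i < 5\<close> lies on arm \<open>i\<close>
  at depth \<open>j + 1\<close>, so the leaves are the last block of five.\<close>

definition leaves :: "nat \<Rightarrow> nat set" where
  "leaves L = {5 * (L - 1)<..5 * L}"

text \<open>Five arms of length \<open>L\<close> attached to the centre 0. The subtraction is truncated, so that the
  first nodes \<open>1, ..., 5\<close> of the arms are adjacent to 0.\<close>

definition spider :: "nat \<Rightarrow> nat \<Rightarrow> nat \<Rightarrow> bool" where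
  "spider L u v \<longleftrightarrow> u \<le> 5 * L \<and> v \<le> 5 * L \<and> u \<noteq> v \<and> (u = v - 5 \<or> v = u - 5)"

definition input :: "nat set \<Rightarrow> nat \<Rightarrow> nat" where
  "input X = (\<lambda>v. of_bool (v \<in> X))"

text \<open>The output \<open>a + 2 * d\<close> encodes two bits. The bits \<open>d\<close> describe a set \<open>Y\<close> up to complement, and the
  bits \<open>a\<close> must satisfy the stabiliser relation of the state \<open>|Y> + |V - Y>\<close> for the measured Paulis.\<close>

definition ghz_problem :: problem where
  "ghz_problem = \<lparr>
     pr_inst = \<lambda>V E x. \<exists>L X. L > 0 \<and> V = {..5 * L} \<and> E = spider L \<and>
       X \<subseteq> leaves L \<and> even (card X) \<and> x = input X,
     pr_valid = \<lambda>V E x out. \<exists>Y. (\<forall>v\<in>V - {0}. odd (out v div 2) = ((v - 5 \<in> Y) \<noteq> (v \<in> Y))) \<and>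
       even ((\<Sum>v\<in>V. out v + x v * of_bool (v \<in> Y)) + (\<Sum>v\<in>V. x v) div 2)\<rparr>"

lemma network_spider: "network {..5 * L} (spider L)"
  by (auto simp: network_def spider_def)

lemma leaves_subset: "leaves L \<subseteq> {..5 * L}"
  by (auto simp: leaves_def)

lemma sum_input:
  assumes "finite V" "X \<subseteq> V"
  shows "(\<Sum>v\<in>V. input X v * g v) = sum g X"
proof -
  have "(\<Sum>v\<in>V. input X v * g v) = (\<Sum>v\<in>V. if v \<in> X then g v else 0)"
    by (intro sum.cong) (auto simp: input_def)
  also have "\<dots> = sum g (V \<inter> X)"
    using assms(1) by (simp add: sum.inter_restrict)
  also have "V \<inter> X = X"
    using assms(2) by blast
  finally show ?thesis .
qed

lemma sum_input_card:
  assumes "finite V" "X \<subseteq> V"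
  shows "sum (input X) V = card X"
  using sum_input[OF assms, of "\<lambda>_. 1"] by simp

lemma instance_sizes_ghz_problem: "instance_sizes ghz_problem = {5 * L + 1 | L. L > 0}"
proof -
  have "5 * L + 1 \<in> instance_sizes ghz_problem" if "L > 0" for L
  proof -
    have "pr_inst ghz_problem {..5 * L} (spider L) (input {})"
      unfolding ghz_problem_def using that by (auto intro!: exI[of _ L])
    moreover have "card {..5 * L} = 5 * L + 1" by simp
    ultimately show ?thesis
      unfolding instance_sizes_def using network_spider[of L] by (intro CollectI exI conjI) (rule sym)
  qed
  then show ?thesis by (auto simp: instance_sizes_def ghz_problem_def)
qed

lemma infinite_instance_sizes: "infinite (instance_sizes ghz_problem)"
proof
  assume "finite (instance_sizes ghz_problem)"
  then have "finite ((\<lambda>L. 5 * L + 1) ` {0::nat<..})"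
    by (rule finite_subset[rotated]) (auto simp: instance_sizes_ghz_problem)
  then have "finite {0::nat<..}"
    by (rule finite_imageD) (simp add: inj_on_def)
  then show False by (simp add: infinite_Ioi)
qed

text \<open>The success probability is 1. Any \<open>Y\<close> whose coboundary the messages show
  satisfies the label condition, so an invalid outcome has odd parity for it, and
  \<open>q_final_zero\<close> applies.\<close>

lemma ghz_alg_solves: "quantumly_solves ghz_problem 2 ghz_alg"
  unfolding quantumly_solves_def
proof (intro conjI allI impI)
  show "q_wellformed ghz_alg 2" by (rule ghz_alg_wellformed)
next
  fix V E x assume "network V E \<and> pr_inst ghz_problem V E x"
  then obtain L X where L: "L > 0" and V: "V = {..5 * L}" and E: "E = spider L"
    and X: "X \<subseteq> leaves L" "even (card X)" and x: "x = input X" and net: "network V E"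
    by (auto simp: ghz_problem_def)
  interpret ghz_network V E x by standard (rule net)
  let ?Q = "q_qubits ghz_alg 2 V E"
  have norm: "(\<Sum>c\<in>configs ?Q. (cmod (q_final ghz_alg 2 V E x c))\<^sup>2) = 1"
    by (rule q_final_norm[OF ghz_alg_wellformed]) auto
  \<comment> \<open>A sum over an infinite set would be 0, not 1.\<close>
  then have "finite (configs ?Q)" by (metis sum.infinite zero_neq_one)
  have "even (\<Sum>v\<in>V. x v)"
    using X leaves_subset[of L] sum_input_card[of V X] by (auto simp: x V)
  have zero: "q_final ghz_alg 2 V E x c = 0" if inv: "\<not> pr_valid ghz_problem V E x (q_output ghz_alg 2 V E x c)" for c
  proof (rule q_final_zero)
    show "even (\<Sum>v\<in>V. x v)" by fact
    fix Y assume Y: "Y \<subseteq> V" "\<And>u v. E v u \<Longrightarrow> c (Msg 2 u v 0) = ((u \<in> Y) \<noteq> (v \<in> Y))"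
    let ?o = "q_output ghz_alg 2 V E x c"
    \<comment> \<open>The ownership test matters at the centre, where \<open>v - 5 = v\<close>: no
      such message exists and the bit reads as 0.\<close>
    have o: "?o v = of_bool (c (Loc v 0)) + 2 * of_bool (Msg 2 (v - 5) v 0 \<in> S 3 v \<and> c (Msg 2 (v - 5) v 0))" if "v \<in> V" for v
      using that Loc_S[of v 3, unfolded S_def] by (simp add: q_output_def ghz_alg_def S_def restr_def)
    have "odd (?o v div 2) = ((v - 5 \<in> Y) \<noteq> (v \<in> Y))" if v: "v \<in> V - {0}" for v
    proof -
      have e: "E v (v - 5)" using v by (auto simp: E V spider_def)
      then have "?o v = of_bool (c (Loc v 0)) + 2 * of_bool ((v - 5 \<in> Y) \<noteq> (v \<in> Y))"
        using o[of v] Y(2)[OF e] Msg_S(3)[OF e] v by simp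
      then show ?thesis by simp
    qed
    then have "odd ((\<Sum>v\<in>V. ?o v + x v * of_bool (v \<in> Y)) + (\<Sum>v\<in>V. x v) div 2)"
      using inv by (auto simp: ghz_problem_def)
    moreover have "(\<Sum>v\<in>V. ?o v + x v * of_bool (v \<in> Y)) = (\<Sum>v\<in>V. of_bool (c (Loc v 0)) + x v * of_bool (v \<in> Y))
        + 2 * (\<Sum>v\<in>V. of_bool (Msg 2 (v - 5) v 0 \<in> S 3 v \<and> c (Msg 2 (v - 5) v 0)))"
      unfolding sum_distrib_left sum.distrib[symmetric] by (intro sum.cong refl) (simp add: o)
    ultimately show "odd ((\<Sum>v\<in>V. of_bool (c (Loc v 0)) + x v * of_bool (v \<in> Y)) + (\<Sum>v\<in>V. x v) div 2)"
      by simp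
  qed
  have "(\<Sum>c \<in> {c \<in> configs ?Q. pr_valid ghz_problem V E x (q_output ghz_alg 2 V E x c)}.
            (cmod (q_final ghz_alg 2 V E x c))\<^sup>2) = (\<Sum>c\<in>configs ?Q. (cmod (q_final ghz_alg 2 V E x c))\<^sup>2)"
    using \<open>finite (configs ?Q)\<close> zero by (intro sum.mono_neutral_left) auto
  then show "(\<Sum>c \<in> {c \<in> configs ?Q. pr_valid ghz_problem V E x (q_output ghz_alg 2 V E x c)}.
            (cmod (q_final ghz_alg 2 V E x c))\<^sup>2) \<ge> 2/3"
    using norm by simp
qed

subsection \<open>The classical lower bound\<close>

text \<open>Light cone argument: the inputs differ only where \<open>h\<close> is at least
  \<open>L\<close>, and a difference descends by at most one level of \<open>h\<close> per
  round.\<close>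

lemma c_state_local:
  assumes h: "\<And>u v. E u v \<Longrightarrow> h u \<le> h v + 1"
    and x: "\<And>v. h v < L \<Longrightarrow> x v = x' v"
  shows "r + h v < L \<Longrightarrow> c_state A E x p s r v = c_state A E x' p s r v"
proof (induction r arbitrary: v)
  case 0
  then show ?case using x by simp
next
  case (Suc r)
  have "c_state A E x p s r u = c_state A E x' p s r u" if "E u v" for u
    using h[OF that] Suc.prems by (intro Suc.IH) simp
  then have "(\<lambda>u. if E u v then c_send A r (c_state A E x p s r u) v else DList [])
      = (\<lambda>u. if E u v then c_send A r (c_state A E x' p s r u) v else DList [])"
    by auto
  then show ?case using Suc by simp
qed

text \<open>For \<open>w > 0\<close>, \<open>(w + 4) mod 5\<close> is the arm and
  \<open>(w + 4) div 5\<close> the depth. The leaves of the other arms are at distance at least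
  \<open>L\<close> from the centre and from arm \<open>i\<close>, too far for \<open>T\<close>
  rounds.\<close>

lemma c_output_spider_local:
  assumes "T < L" "X \<subseteq> leaves L" "X' \<subseteq> leaves L"
    and "\<And>w. w \<in> leaves L \<Longrightarrow> (w + 4) mod 5 = i \<Longrightarrow> w \<in> X \<longleftrightarrow> w \<in> X'"
    and v: "v = 0 \<or> (v + 4) mod 5 = i"
  shows "c_output A V (spider L) (input X) T p s v = c_output A V (spider L) (input X') T p s v"
proof -
  \<comment> \<open>distance to the centre, with arm \<open>i\<close> contracted to the centre\<close>
  define h :: "nat \<Rightarrow> nat" where "h w = (if (w + 4) mod 5 = i then 0 else (w + 4) div 5)" for w
  have "h v = 0" using v by (auto simp: h_def)
  have "h u \<le> h w + 1" if "spider L u w" for u w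
  proof -
    have *: "h (w - 5) \<le> h w + 1" "h w \<le> h (w - 5) + 1" for w
    proof -
      \<comment> \<open>Up to 5 the parent is the centre; from 6 on, \<open>w\<close> and
        \<open>w - 5\<close> lie on the same arm at consecutive depths.\<close>
      consider "w \<le> 5" | "w \<ge> 6" by linarith
      then have "h (w - 5) \<le> h w + 1 \<and> h w \<le> h (w - 5) + 1"
      proof cases
        case 1
        then have "w - 5 = 0" "(w + 4) div 5 \<le> 1" by auto
        then show ?thesis by (simp add: h_def)
      next
        case 2
        then obtain k where "w = k + 6" by (metis add.commute le_Suc_ex)
        then have "w + 4 = (k + 5) + 5" "w - 5 + 4 = k + 5" by simp_all
        then show ?thesis unfolding h_def by (simp only: mod_add_self2 div_add_self2) simp
      qed
      then show "h (w - 5) \<le> h w + 1" "h w \<le> h (w - 5) + 1" by auto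
    qed
    then show ?thesis using that by (auto simp: spider_def)
  qed
  moreover have "input X w = input X' w" if "h w < L" for w
  proof (cases "w \<in> leaves L")
    case True
    then have "(w + 4) div 5 = L" using assms(1) unfolding leaves_def by auto
    then have "(w + 4) mod 5 = i" using that by (auto simp: h_def split: if_splits)
    then show ?thesis using assms(4)[OF True] by (simp add: input_def)
  qed (use assms(2,3) in \<open>auto simp: input_def\<close>)
  ultimately have "c_state A (spider L) (input X) p s T v = c_state A (spider L) (input X') p s T v"
    using \<open>h v = 0\<close> assms(1) by (intro c_state_local[where h = h and L = L]) auto
  then show ?thesis by (simp add: c_output_def)
qed

lemma sum_spider:
  fixes F :: "nat \<Rightarrow> nat"
  shows "(\<Sum>v\<le>5 * L. F v) = F 0 + (\<Sum>i<5. \<Sum>j<L. F (5 * j + i + 1))"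
proof (induction L)
  case (Suc L)
  have five: "(\<Sum>i<5. G i) = G 0 + G 1 + G 2 + G 3 + G 4" for G :: "nat \<Rightarrow> nat"
    by (simp add: eval_nat_numeral)
  have "(\<Sum>v\<le>a + 5. F v) = (\<Sum>v\<le>a. F v) + (\<Sum>i<5. F (a + i + 1))" for a
    by (simp add: eval_nat_numeral)
  from this[of "5 * L"] have "(\<Sum>v\<le>5 * Suc L. F v) = (\<Sum>v\<le>5 * L. F v) + (\<Sum>i<5. F (5 * L + i + 1))"
    by (simp add: add.commute)
  then show ?case unfolding Suc.IH by (simp add: sum.distrib)
qed simp

section \<open>Counting wins in Mermin's game\<close>

lemma sum_Pow_insert:
  fixes f :: "'a set \<Rightarrow> nat"
  assumes "finite A" "a \<notin> A"
  shows "sum f (Pow (insert a A)) = (\<Sum>B\<in>Pow A. f B + f (insert a B))"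
proof -
  have "sum f (Pow (insert a A)) = sum f (Pow A) + sum f (insert a ` Pow A)"
    unfolding Pow_insert using assms by (intro sum.union_disjoint) auto
  also have "sum f (insert a ` Pow A) = (\<Sum>B\<in>Pow A. f (insert a B))"
    using assms(2) by (subst sum.reindex) (auto simp: inj_on_def)
  finally show ?thesis by (simp add: sum.distrib)
qed

definition even_sets :: "nat set set" where
  "even_sets = {B. B \<subseteq> {..<5} \<and> even (card B)}"

text \<open>Turns the count into a sum over a power set, which \<open>sum_Pow_insert\<close> expands
  into explicit terms.\<close>

lemma even_sets_count:
  "card {B \<in> even_sets. P B} = (\<Sum>B\<in>Pow {0, 1, 2, 3, 4}. of_bool (even (card B) \<and> P B))"
proof -
  have "{..<5} = {0, 1, 2, 3, 4 :: nat}" by auto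
  then have "{B \<in> even_sets. P B} = {B \<in> Pow {0, 1, 2, 3, 4}. even (card B) \<and> P B}"
    by (auto simp: even_sets_def)
  then show ?thesis by (simp add: of_bool_def sum.If_cases Int_def)
qed

lemma card_even_sets: "card even_sets = 16"
  using even_sets_count[of "\<lambda>_. True"] by (simp add: sum_Pow_insert del: sum_of_bool_eq)

text \<open>Mermin's five-party GHZ game, for a deterministic classical strategy: \<open>B\<close> is the set of players
  with input 1, \<open>K\<close> the sum of the answers to input 0, and \<open>c i\<close> the change of player \<open>i\<close>'s answer.\<close>

lemma mermin_game:
  "card {B \<in> even_sets. even (K + (\<Sum>i\<in>B. c i) + card B div 2)} \<le> 10"
proof -
  \<comment> \<open>The empty set, the ten pairs and the five sets of size four.\<close>
  have "card {B \<in> even_sets. even (K + (\<Sum>i\<in>B. c i) + card B div 2)} =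
    of_bool (even (K)) + of_bool (even (K + c 0 + c 1 + 1)) + of_bool (even (K + c 0 + c 2 + 1))
    + of_bool (even (K + c 0 + c 3 + 1)) + of_bool (even (K + c 0 + c 4 + 1)) + of_bool (even (K + c 1 + c 2 + 1))
    + of_bool (even (K + c 1 + c 3 + 1)) + of_bool (even (K + c 1 + c 4 + 1)) + of_bool (even (K + c 2 + c 3 + 1))
    + of_bool (even (K + c 2 + c 4 + 1)) + of_bool (even (K + c 3 + c 4 + 1)) + of_bool (even (K + c 0 + c 1 + c 2 + c 3 + 2))
    + of_bool (even (K + c 0 + c 1 + c 2 + c 4 + 2)) + of_bool (even (K + c 0 + c 1 + c 3 + c 4 + 2)) + of_bool (even (K + c 0 + c 2 + c 3 + c 4 + 2))
    + of_bool (even (K + c 1 + c 2 + c 3 + c 4 + 2))"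
    unfolding even_sets_count by (simp add: sum_Pow_insert add_ac del: sum_of_bool_eq)
  also have "\<dots> \<le> 10"
    by (cases "even K"; cases "even (c 0)"; cases "even (c 1)"; cases "even (c 2)";
        cases "even (c 3)"; cases "even (c 4)") simp_all
  finally show ?thesis .
qed

text \<open>The labels are differences of membership between a node and its parent, so their sum
  telescopes along the arm.\<close>

lemma spider_arm_labels:
  assumes lab: "\<And>v. v \<in> {..5 * L} - {0} \<Longrightarrow> odd (d v) = ((v - 5 \<in> Y) \<noteq> (v \<in> Y))"
    and "i < 5" "k < L"
  shows "5 * k + i + 1 \<in> Y \<longleftrightarrow> (0 \<in> Y) \<noteq> odd (\<Sum>j<Suc k. d (5 * j + i + 1) :: nat)"
  using assms(3)
proof (induction k)
  case 0
  \<comment> \<open>The parent of the first node of an arm is 0 by truncated subtraction.\<close>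
  then show ?case using lab[of "i + 1"] assms(2) by auto
next
  case (Suc k)
  have "5 * Suc k + i + 1 - 5 = 5 * k + i + 1" "5 * Suc k + i + 1 \<in> {..5 * L} - {0}"
    using Suc.prems assms(2) by auto
  then show ?case using lab[of "5 * Suc k + i + 1"] Suc by (auto simp del: mult_Suc_right)
qed

text \<open>The bit \<open>z\<close>, in use the membership of the centre, is counted
  \<open>card B\<close> times, an even number, and cancels.\<close>

lemma even_sum_of_bool_xor:
  assumes "finite B" "even (card B)"
  shows "even (\<Sum>i\<in>B. of_bool (z \<noteq> odd (d i)) :: nat) \<longleftrightarrow> even (\<Sum>i\<in>B. d i :: nat)"
proof -
  have "even (\<Sum>i\<in>B. of_bool (z \<noteq> odd (d i)) :: nat) \<longleftrightarrow> even (card B * of_bool z + (\<Sum>i\<in>B. d i))"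
    using assms(1) by (induction B rule: finite_induct) (auto simp del: sum_of_bool_eq)
  then show ?thesis using assms(2) by simp
qed

section \<open>Deterministic algorithms as strategies for the game\<close>

definition leaf :: "nat \<Rightarrow> nat \<Rightarrow> nat" where
  "leaf L i = 5 * (L - 1) + i + 1"

lemma inj_leaf: "inj (leaf L)"
  by (auto simp: inj_def leaf_def)

lemma leaf_image_subset:
  assumes "L > 0" "B \<subseteq> {..<5}"
  shows "leaf L ` B \<subseteq> leaves L"
  using assms by (cases L) (auto simp: leaf_def leaves_def)

text \<open>By locality arm \<open>i\<close> acts as a player who sees only whether
  \<open>i \<in> B\<close>, and every valid output wins the game for the strategy \<open>K\<close>,
  \<open>c\<close>.\<close>

lemma deterministic_wins:
  assumes "T < L"
  shows "card {B \<in> even_sets. pr_valid ghz_problem {..5 * L} (spider L) (input (leaf L ` B))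
      (c_output A {..5 * L} (spider L) (input (leaf L ` B)) T p s)} \<le> 10"
proof -
  have L: "L > 0" using assms by simp
  let ?V = "{..5 * L}"
  let ?o = "\<lambda>X. c_output A ?V (spider L) (input X) T p s"
  \<comment> \<open>Reference runs with input 1, or input 0, at all leaves. The labels
    \<open>d i\<close> are taken at input 1 because only leaves with that input enter the
    correction.\<close>
  define Q where "Q b = ?o (if b then leaves L else {})" for b
  define R where "R i b = (\<Sum>j<L. Q b (5 * j + i + 1))" for i b
  define d where "d i = (\<Sum>j<L. Q True (5 * j + i + 1) div 2)" for i
  define c where "c i = R i False + R i True + d i" for i
  define K where "K = Q False 0 + (\<Sum>i<5. R i False)"
  have "even (K + (\<Sum>i\<in>B. c i) + card B div 2)"
    if B: "B \<in> even_sets"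
      and val: "pr_valid ghz_problem ?V (spider L) (input (leaf L ` B)) (?o (leaf L ` B))" for B
  proof -
    let ?X = "leaf L ` B"
    have B5: "B \<subseteq> {..<5}" and evB: "even (card B)" using B by (auto simp: even_sets_def)
    have finB: "finite B" using B5 by (rule finite_subset) simp
    have X: "?X \<subseteq> leaves L" using leaf_image_subset[OF L B5] .
    then have XV: "?X \<subseteq> ?V" using leaves_subset by blast
    have cardX: "card ?X = card B" using inj_leaf by (simp add: card_image inj_on_def inj_def)
    \<comment> \<open>No arm has index 5, so the agreement condition on leaves is vacuous and the
      centre sees no input.\<close>
    have o0: "?o ?X 0 = Q False 0"
      unfolding Q_def using X by (intro c_output_spider_local[OF assms, where i = 5]) auto
    have oi: "?o ?X (5 * j + i + 1) = Q (i \<in> B) (5 * j + i + 1)" if "i < 5" for i j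
      unfolding Q_def
    proof (rule c_output_spider_local[OF assms X, where i = i])
      fix w assume w: "w \<in> leaves L" "(w + 4) mod 5 = i"
      have "w = leaf L (w - 5 * (L - 1) - 1)" "w - 5 * (L - 1) - 1 < 5"
        using w(1) L by (auto simp: leaves_def leaf_def)
      moreover have "(leaf L k + 4) mod 5 = k" if "k < 5" for k
      proof -
        have "leaf L k + 4 = k + 5 * L" using L by (cases L) (auto simp: leaf_def)
        then show ?thesis using that by simp
      qed
      ultimately have "w = leaf L i" using w(2) by metis
      then have "w \<in> ?X \<longleftrightarrow> i \<in> B" using inj_leaf by (auto simp: inj_def)
      then show "w \<in> ?X \<longleftrightarrow> w \<in> (if i \<in> B then leaves L else {})" using w(1) by simp
    next
      have "5 * j + i + 1 + 4 = i + 5 * (j + 1)" by simp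
      then have "(5 * j + i + 1 + 4) mod 5 = i" using that by (metis mod_less mod_mult_self2)
      then show "5 * j + i + 1 = 0 \<or> (5 * j + i + 1 + 4) mod 5 = i" by simp
    qed auto
    obtain Y where Y: "\<And>v. v \<in> ?V - {0} \<Longrightarrow> odd (?o ?X v div 2) = ((v - 5 \<in> Y) \<noteq> (v \<in> Y))"
      and par: "even ((\<Sum>v\<in>?V. ?o ?X v + input ?X v * of_bool (v \<in> Y)) + (\<Sum>v\<in>?V. input ?X v) div 2)"
      using val unfolding ghz_problem_def problem.simps by blast
    have "leaf L i \<in> Y \<longleftrightarrow> (0 \<in> Y) \<noteq> odd (d i)" if "i \<in> B" for i
    proof -
      have i: "i < 5" using that B5 by auto
      have "d i = (\<Sum>j<Suc (L - 1). ?o ?X (5 * j + i + 1) div 2)"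
        using that oi[OF i] L by (simp add: d_def)
      then show ?thesis
        using spider_arm_labels[of L "\<lambda>v. ?o ?X v div 2" Y i "L - 1", OF Y i] L by (simp add: leaf_def)
    qed
    then have "(\<Sum>v\<in>?X. of_bool (v \<in> Y)) = (\<Sum>i\<in>B. of_bool ((0 \<in> Y) \<noteq> odd (d i)) :: nat)"
      using inj_leaf by (subst sum.reindex) (auto simp: inj_on_def inj_def intro!: sum.cong)
    then have lab: "even (\<Sum>v\<in>?X. of_bool (v \<in> Y) :: nat) \<longleftrightarrow> even (\<Sum>i\<in>B. d i)"
      using even_sum_of_bool_xor[OF finB evB] by simp
    have out: "(\<Sum>v\<in>?V. ?o ?X v) = Q False 0 + (\<Sum>i<5. R i (i \<in> B))"
      unfolding sum_spider o0 R_def by (simp add: oi[simplified])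
    \<comment> \<open>Replacing the answers of the players in \<open>B\<close> is stated with sums
      on both sides to avoid subtraction on naturals.\<close>
    have "(\<Sum>i<5. R i (i \<in> B)) + (\<Sum>i\<in>B. R i False) = (\<Sum>i<5. R i False) + (\<Sum>i\<in>B. R i True)"
    proof -
      have "{..<5} = B \<union> ({..<5} - B)" using B5 by auto
      then have split: "(\<Sum>i<5. g i) = sum g B + sum g ({..<5} - B)" for g :: "nat \<Rightarrow> nat"
        using finB by (metis Diff_disjoint finite_Diff finite_lessThan sum.union_disjoint)
      show ?thesis unfolding split by simp
    qed
    then have R: "even (\<Sum>i<5. R i (i \<in> B)) \<longleftrightarrow> even ((\<Sum>i<5. R i False) + (\<Sum>i\<in>B. R i True) + (\<Sum>i\<in>B. R i False))"
      by presburger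
    have "even (Q False 0 + (\<Sum>i<5. R i (i \<in> B)) + (\<Sum>v\<in>?X. of_bool (v \<in> Y)) + card B div 2)"
      using par unfolding sum.distrib out
      by (simp only: sum_input[OF _ XV] sum_input_card[OF _ XV] cardX finite_atMost)
    then show ?thesis
      unfolding K_def c_def sum.distrib using R lab by presburger
  qed
  then have "card {B \<in> even_sets. pr_valid ghz_problem ?V (spider L) (input (leaf L ` B)) (?o (leaf L ` B))}
     \<le> card {B \<in> even_sets. even (K + (\<Sum>i\<in>B. c i) + card B div 2)}"
    by (intro card_mono) (auto simp: even_sets_def intro: finite_subset[of _ "Pow {..<5}"])
  also have "\<dots> \<le> 10" by (rule mermin_game)
  finally show ?thesis .
qed

section \<open>Averaging over the randomness\<close>

lemma prob_space_rand_space: "prob_space (rand_space V)"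
proof -
  have U: "prob_space U01"
    unfolding U01_def by (intro prob_space_uniform_measure) auto
  then have "prob_space (PiM V (\<lambda>_. U01))"
    by (intro prob_space_PiM)
  then show ?thesis
    unfolding rand_space_def using U by (rule prob_space_pair)
qed

text \<open>The sum of the probabilities is the expected number of events that occur.\<close>

lemma (in prob_space) sum_prob_le:
  assumes "finite I" "\<And>i. i \<in> I \<Longrightarrow> F i \<in> sets M"
    and "\<And>\<omega>. \<omega> \<in> space M \<Longrightarrow> card {i \<in> I. \<omega> \<in> F i} \<le> n"
  shows "(\<Sum>i\<in>I. prob (F i)) \<le> n"
proof -
  have "(\<Sum>i\<in>I. prob (F i)) = (\<Sum>i\<in>I. expectation (indicator (F i)))"
    using assms(2) by simp
  also have "\<dots> = expectation (\<lambda>\<omega>. \<Sum>i\<in>I. indicator (F i) \<omega>)"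
    using assms(2) by (intro Bochner_Integration.integral_sum[symmetric]) (auto simp: integrable_indicator_iff less_top[symmetric])
  also have "\<dots> \<le> n"
  proof (rule integral_le_const)
    show "integrable M (\<lambda>\<omega>. \<Sum>i\<in>I. indicator (F i) \<omega> :: real)"
      using assms(2) by (intro Bochner_Integration.integrable_sum) (auto simp: integrable_indicator_iff less_top[symmetric])
    show "AE \<omega> in M. (\<Sum>i\<in>I. indicator (F i) \<omega>) \<le> real n"
    proof (rule AE_I2)
      fix \<omega> assume "\<omega> \<in> space M"
      have "(\<Sum>i\<in>I. indicator (F i) \<omega>) = real (card {i \<in> I. \<omega> \<in> F i})"
        using assms(1) by (simp add: indicator_def sum.If_cases Int_def)
      then show "(\<Sum>i\<in>I. indicator (F i) \<omega>) \<le> real n" using assms(3)[OF \<open>\<omega> \<in> space M\<close>] by simp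
    qed
  qed
  finally show ?thesis .
qed

text \<open>Sixteen inputs solved with probability 2/3 each would give 32/3 expected wins, but each
  value of the randomness yields at most 10.\<close>

lemma classical_rounds:
  assumes "classically_solves ghz_problem (5 * L + 1) T A" "L > 0"
  shows "T \<ge> L"
proof (rule ccontr)
  assume "\<not> T \<ge> L"
  then have T: "T < L" by simp
  let ?V = "{..5 * L}"
  let ?good = "\<lambda>B p s. pr_valid ghz_problem ?V (spider L) (input (leaf L ` B))
      (c_output A ?V (spider L) (input (leaf L ` B)) T p s)"
  interpret prob_space "rand_space ?V" by (rule prob_space_rand_space)
  have fin: "finite even_sets"
    using card_even_sets by (intro card_ge_0_finite) simp
  have "\<exists>F \<in> sets (rand_space ?V). F \<subseteq> {\<omega> \<in> space (rand_space ?V). ?good B (fst \<omega>) (snd \<omega>)}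
      \<and> prob F \<ge> 2/3" if B: "B \<in> even_sets" for B
  proof -
    have "card (leaf L ` B) = card B" using inj_leaf by (simp add: card_image inj_on_def inj_def)
    then have "pr_inst ghz_problem ?V (spider L) (input (leaf L ` B))"
      using B assms(2) leaf_image_subset[of L B] unfolding ghz_problem_def even_sets_def problem.simps
      by (intro exI[of _ L] exI[of _ "leaf L ` B"] conjI refl) simp_all
    then show ?thesis
      using assms(1) network_spider[of L] unfolding classically_solves_def by simp
  qed
  then have "\<forall>B\<in>even_sets. \<exists>F. F \<in> sets (rand_space ?V)
      \<and> F \<subseteq> {\<omega> \<in> space (rand_space ?V). ?good B (fst \<omega>) (snd \<omega>)} \<and> prob F \<ge> 2/3"
    by blast
  \<comment> \<open>Measurable subsets stand in for the success events, which may fail to be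
    measurable.\<close>
  from bchoice[OF this] obtain F where F: "\<And>B. B \<in> even_sets \<Longrightarrow> F B \<in> sets (rand_space ?V)"
    "\<And>B. B \<in> even_sets \<Longrightarrow> F B \<subseteq> {\<omega> \<in> space (rand_space ?V). ?good B (fst \<omega>) (snd \<omega>)}"
    "\<And>B. B \<in> even_sets \<Longrightarrow> prob (F B) \<ge> 2/3"
    by blast
  have "(\<Sum>B\<in>even_sets. prob (F B)) \<le> 10"
  proof -
    have "card {B \<in> even_sets. \<omega> \<in> F B} \<le> 10" for \<omega>
    proof -
      have "card {B \<in> even_sets. \<omega> \<in> F B} \<le> card {B \<in> even_sets. ?good B (fst \<omega>) (snd \<omega>)}"
        using F(2) fin by (intro card_mono) auto
      also have "\<dots> \<le> 10" by (rule deterministic_wins[OF T])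
      finally show ?thesis .
    qed
    then have "(\<Sum>B\<in>even_sets. prob (F B)) \<le> real 10"
      using F(1) fin by (intro sum_prob_le) auto
    then show ?thesis by simp
  qed
  moreover have "(\<Sum>B\<in>even_sets. prob (F B)) \<ge> (\<Sum>B\<in>even_sets. 2/3)"
    using F(3) by (intro sum_mono)
  ultimately show False by (simp add: card_even_sets)
qed

theorem theorem1:
  shows "\<exists>P :: problem.
     infinite (instance_sizes P)
   \<and> (\<exists>A. quantumly_solves P 2 A)
   \<and> (\<exists>c :: real. c > 0 \<and> (\<exists>N0. \<forall>n \<ge> N0. n \<in> instance_sizes P \<longrightarrow>
        (\<forall>(A :: calg) (T :: nat). classically_solves P n T A \<longrightarrow> real T \<ge> c * real n)))"
proof (intro exI conjI)
  show "infinite (instance_sizes ghz_problem)" by (rule infinite_instance_sizes)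
  show "quantumly_solves ghz_problem 2 ghz_alg" by (rule ghz_alg_solves)
  \<comment> \<open>The constant works because \<open>5 * L + 1 \<le> 6 * L\<close> for
    \<open>L > 0\<close>.\<close>
  show "(1 / 6 :: real) > 0" by simp
  show "\<forall>n \<ge> 0. n \<in> instance_sizes ghz_problem \<longrightarrow>
        (\<forall>(A :: calg) (T :: nat). classically_solves ghz_problem n T A \<longrightarrow> real T \<ge> 1 / 6 * real n)"
  proof (intro allI impI)
    fix n T and A :: calg
    assume "n \<in> instance_sizes ghz_problem" and sol: "classically_solves ghz_problem n T A"
    then obtain L where L: "n = 5 * L + 1" "L > 0"
      by (auto simp: instance_sizes_ghz_problem)
    then have "T \<ge> L" using sol classical_rounds by blast
    then show "real T \<ge> 1 / 6 * real n" using L by simp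
  qed
qed

end
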